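(* Let $\mathbb{F}_q$ be a finite field of characteristic $p\neq 2$, let $a,b\in\mathbb{F}_q$ with $ab(a-b)\neq 0$, and let $E=\tilde{\mathcal{H}}_{a,b}: X(aY^2-Z^2)=Y(bX^2-Z^2)$ be the generalized Huff curve with neutral element $O=(0:0:1)$. Let $r>5$ be a prime with $r\neq p$ and $r\mid \#E(\mathbb{F}_q)$, and suppose the embedding degree $k$ of $E$ with respect to $r$ is even. Let $P\in E(\mathbb{F}_q)$ be a point of order $r$, and let $Q\in E(\mathbb{F}_{q^k})[r]\setminus E(\mathbb{F}_q)$ be of the form $Q=(1:y_Q:z_Q\alpha)$ with $y_Q,z_Q\in\mathbb{F}_{q^{k/2}}$. Then the doubling step of the Miller loop computing the reduced Tate pairing of $P$ and $Q$, that is, the step which from the current projective point $R=(X_R:Y_R:Z_R)\in E(\mathbb{F}_q)$ and the current value $f\in\mathbb{F}_{q^k}$ computes projective coordinates of $2R$ together with $f^2\cdot g_{R,R}(Q)$ (the latter up to a factor in $\mathbb{F}_{q^{k/2}}^{*}$), can be performed at cost $$1\mathbf{M}+1\mathbf{S}+(k+12)\mathbf{m}+5\mathbf{s}+2\mathbf{c}.$$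
   Context: Embedding degree: the smallest positive integer $k$ with $r\mid q^k-1$. The element $\alpha\in\mathbb{F}_{q^k}$ satisfies $\mathbb{F}_{q^k}=\mathbb{F}_{q^{k/2}}(\alpha)$ with $\alpha^2$ a non-square in $\mathbb{F}_{q^{k/2}}$. Group law: on the smooth plane cubic $E$, the point $O=(0:0:1)$ is an inflection point and is the neutral element of the chord-and-tangent law. Functions: for $R_1,R_2\in E(\mathbb{F}_q)$, let $l_{R_1,R_2}$ be the rational function on $E$ obtained by dividing by $X$ a nonzero linear form over $\mathbb{F}_q$ defining the line through $R_1$ and $R_2$ (the tangent line to $E$ at $R_1$ if $R_1=R_2$); it is defined up to a constant in $\mathbb{F}_q^*$. Put $g_{R_1,R_2}=l_{R_1,R_2}/l_{R_1+R_2,O}$. Miller loop: write $r=(r_l,r_{l-1},\dots,r_0)_2$ in binary with $r_l=1$. Start with $R\gets P$, $f\gets 1$. For $i=l-1,\dots,0$: (doubling step) $f\gets f^2\cdot g_{R,R}(Q)$, $R\gets 2R$; then, if $r_i=1$, (addition step) $f\gets f\cdot g_{R,P}(Q)$, $R\gets R+P$. Finally output $f^{(q^k-1)/r}$. Factors lying in $\mathbb{F}_{q^{k/2}}^*$ may be dropped from $f$ at any step, because they become $1$ in the final exponentiation. Cost model: $\mathbf{M}$ and $\mathbf{S}$ are the costs of a multiplication and of a squaring in $\mathbb{F}_{q^k}$; $\mathbf{m}$ and $\mathbf{s}$ are the costs of a multiplication and of a squaring in $\mathbb{F}_q$; $\mathbf{c}$ is the cost of a multiplication of an element of $\mathbb{F}_q$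 by one of the curve constants $a$, $b$. Multiplying an element of $\mathbb{F}_q$ by an element of $\mathbb{F}_{q^{k/2}}$, or by an element of $\mathbb{F}_{q^{k/2}}\cdot\alpha$ (given by $k/2$ coordinates over $\mathbb{F}_q$), costs $\frac{k}{2}\mathbf{m}$. Additions and subtractions (in particular multiplications by small integers such as $2$) are not counted. Quantities depending only on $P$ and $Q$ (not on $R$ or $f$) are precomputed and not counted. "Can be performed at cost $C$" means that there is a sequence of such operations, the same for all occurrences of the step, that computes the required output using at most the number of operations of each kind listed in $C$. *)

theory Defs
  imports "HOL-Computational_Algebra.Computational_Algebra" "HOL-Library.Multiset"
begin

text \<open>
  The field with q^k elements is a type of class field and finite; the fields with q and with
  q^(k/2) elements are subfields of it, given as subsets.
\<close>

definition subfield_of :: "'a::field set \<Rightarrow> bool" where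
  "subfield_of F \<longleftrightarrow> 0 \<in> F \<and> 1 \<in> F \<and>
     (\<forall>x\<in>F. \<forall>y\<in>F. x - y \<in> F \<and> x * y \<in> F) \<and> (\<forall>x\<in>F. inverse x \<in> F)"

definition adjoin :: "'a::field set \<Rightarrow> 'a \<Rightarrow> 'a set" where
  "adjoin F \<alpha> = \<Inter>{K. subfield_of K \<and> F \<subseteq> K \<and> \<alpha> \<in> K}"

definition embedding_degree :: "nat \<Rightarrow> nat \<Rightarrow> nat" where
  "embedding_degree q r = (LEAST k. 0 < k \<and> r dvd q ^ k - 1)"


section \<open>Points and lines of the projective plane\<close>

type_synonym 'a triple = "'a \<times> 'a \<times> 'a"

fun scale :: "'a::comm_ring_1 \<Rightarrow> 'a triple \<Rightarrow> 'a triple" where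
  "scale c (x, y, z) = (c * x, c * y, c * z)"

text \<open>The projective point with given homogeneous coordinates (only meaningful if these are
  not all zero), as the set of all its coordinate triples.\<close>

definition pt :: "'a::field triple \<Rightarrow> 'a triple set" where
  "pt u = {scale c u | c. c \<noteq> 0}"

definition is_coords :: "'a::field set \<Rightarrow> 'a triple set \<Rightarrow> 'a triple \<Rightarrow> bool" where
  "is_coords F R u \<longleftrightarrow> u \<in> F \<times> F \<times> F \<and> u \<noteq> (0, 0, 0) \<and> R = pt u"

text \<open>Value at a coordinate triple of the linear form with the given coefficients.\<close>

fun lin :: "'a::comm_ring_1 triple \<Rightarrow> 'a triple \<Rightarrow> 'a" where
  "lin (l, m, n) (x, y, z) = l * x + m * y + n * z"


section \<open>The generalized Huff curve and its chord-and-tangent law\<close>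

fun huff :: "'a::comm_ring_1 \<Rightarrow> 'a \<Rightarrow> 'a triple \<Rightarrow> 'a" where
  "huff a b (x, y, z) = x * (a * y^2 - z^2) - y * (b * x^2 - z^2)"

text \<open>The three partial derivatives of the cubic form above.\<close>

fun huff_grad :: "'a::comm_ring_1 \<Rightarrow> 'a \<Rightarrow> 'a triple \<Rightarrow> 'a triple" where
  "huff_grad a b (x, y, z) =
     (a * y^2 - z^2 - 2 * b * x * y, 2 * a * x * y - (b * x^2 - z^2), 2 * y * z - 2 * x * z)"

definition huff_points :: "'a::field set \<Rightarrow> 'a \<Rightarrow> 'a \<Rightarrow> 'a triple set set" where
  "huff_points F a b = {pt u | u. u \<in> F \<times> F \<times> F \<and> u \<noteq> (0, 0, 0) \<and> huff a b u = 0}"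

definition huff_O :: "'a::field triple set" where
  "huff_O = pt (0, 0, 1)"

text \<open>The linear form l defines the line through R1 and R2, the tangent line if R1 = R2.\<close>

definition line_through ::
  "'a::field \<Rightarrow> 'a \<Rightarrow> 'a triple set \<Rightarrow> 'a triple set \<Rightarrow> 'a triple \<Rightarrow> bool" where
  "line_through a b R1 R2 l \<longleftrightarrow> l \<noteq> (0, 0, 0) \<and>
     (if R1 = R2 then \<exists>u\<in>R1. \<exists>c. l = scale c (huff_grad a b u)
      else \<forall>u\<in>R1 \<union> R2. lin l u = 0)"

text \<open>The cubic form at u + t v, as a polynomial in t.\<close>

fun huff_along :: "'a::field \<Rightarrow> 'a \<Rightarrow> 'a triple \<Rightarrow> 'a triple \<Rightarrow> 'a poly" where
  "huff_along a b (u1, u2, u3) (v1, v2, v3) =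
     huff [:a:] [:b:] ([:u1, v1:], [:u2, v2:], [:u3, v3:])"

text \<open>The intersection cycle of the curve and the line l = 0 is D. The intersection multiplicity
  at a point u of the line is the order of vanishing at t = 0 of the cubic form at u + t v,
  where v is any second point of the line.\<close>

definition line_meets ::
  "'a::field \<Rightarrow> 'a \<Rightarrow> 'a triple \<Rightarrow> 'a triple set multiset \<Rightarrow> bool" where
  "line_meets a b l D \<longleftrightarrow>
     (\<forall>T\<in>#D. \<exists>u. u \<noteq> (0, 0, 0) \<and> lin l u = 0 \<and> T = pt u) \<and>
     (\<forall>u v. u \<noteq> (0, 0, 0) \<and> v \<notin> range (\<lambda>c. scale c u) \<and> lin l u = 0 \<and> lin l v = 0 \<longrightarrow>
        huff_along a b u v \<noteq> 0 \<and> order 0 (huff_along a b u v) = count D (pt u))"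

definition third_point ::
  "'a::field \<Rightarrow> 'a \<Rightarrow> 'a triple set \<Rightarrow> 'a triple set \<Rightarrow> 'a triple set" where
  "third_point a b R1 R2 =
     (THE R3. \<exists>l. line_through a b R1 R2 l \<and> line_meets a b l {#R1, R2, R3#})"

definition huff_add ::
  "'a::field \<Rightarrow> 'a \<Rightarrow> 'a triple set \<Rightarrow> 'a triple set \<Rightarrow> 'a triple set" where
  "huff_add a b R1 R2 = third_point a b huff_O (third_point a b R1 R2)"

primrec huff_mult :: "'a::field \<Rightarrow> 'a \<Rightarrow> nat \<Rightarrow> 'a triple set \<Rightarrow> 'a triple set" where
  "huff_mult a b 0 R = huff_O"
| "huff_mult a b (Suc n) R = huff_add a b (huff_mult a b n R) R"

definition has_order :: "'a::field \<Rightarrow> 'a \<Rightarrow> 'a triple set \<Rightarrow> nat \<Rightarrow> bool" where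
  "has_order a b R n \<longleftrightarrow> 0 < n \<and> huff_mult a b n R = huff_O \<and>
     (\<forall>m. 0 < m \<and> m < n \<longrightarrow> huff_mult a b m R \<noteq> huff_O)"


section \<open>The functions in the Miller loop\<close>

text \<open>The form is determined up to a nonzero constant of F; an arbitrary choice is made.\<close>

definition line_form ::
  "'a::field set \<Rightarrow> 'a \<Rightarrow> 'a \<Rightarrow> 'a triple set \<Rightarrow> 'a triple set \<Rightarrow> 'a triple" where
  "line_form F a b R1 R2 = (SOME l. l \<in> F \<times> F \<times> F \<and> line_through a b R1 R2 l)"

text \<open>The value of the function at a point with nonzero first coordinate, in terms of arbitrary
  homogeneous coordinates of that point.\<close>

definition miller_l ::
  "'a::field set \<Rightarrow> 'a \<Rightarrow> 'a \<Rightarrow> 'a triple set \<Rightarrow> 'a triple set \<Rightarrow> 'a triple \<Rightarrow> 'a" where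
  "miller_l F a b R1 R2 v = lin (line_form F a b R1 R2) v / fst v"

definition miller_g ::
  "'a::field set \<Rightarrow> 'a \<Rightarrow> 'a \<Rightarrow> 'a triple set \<Rightarrow> 'a triple set \<Rightarrow> 'a triple \<Rightarrow> 'a" where
  "miller_g F a b R1 R2 v =
     miller_l F a b R1 R2 v / miller_l F a b (huff_add a b R1 R2) huff_O v"


section \<open>The cost model\<close>

text \<open>
  A sequence of operations is a straight-line program. The arguments of an operation are positions
  in the list of the values available so far, and its result is appended to that list.
\<close>

datatype operation =
    Add nat nat
  | Sub nat nat
  | Mul_Full nat nat
  | Sq_Full nat
  | Mul_Base nat nat
  | Sq_Base nat
  | Mul_Base_Half nat nat
  | Mul_Const_a nat
  | Mul_Const_b nat

primrec arguments :: "operation \<Rightarrow> nat list" where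
  "arguments (Add i j) = [i, j]"
| "arguments (Sub i j) = [i, j]"
| "arguments (Mul_Full i j) = [i, j]"
| "arguments (Sq_Full i) = [i]"
| "arguments (Mul_Base i j) = [i, j]"
| "arguments (Sq_Base i) = [i]"
| "arguments (Mul_Base_Half i j) = [i, j]"
| "arguments (Mul_Const_a i) = [i]"
| "arguments (Mul_Const_b i) = [i]"

text \<open>The restrictions on the arguments, Fq and Fh being the fields with q and q^(k/2) elements.\<close>

primrec admissible ::
  "'a::field set \<Rightarrow> 'a set \<Rightarrow> 'a \<Rightarrow> 'a list \<Rightarrow> operation \<Rightarrow> bool" where
  "admissible Fq Fh \<alpha> vs (Add i j) \<longleftrightarrow> True"
| "admissible Fq Fh \<alpha> vs (Sub i j) \<longleftrightarrow> True"
| "admissible Fq Fh \<alpha> vs (Mul_Full i j) \<longleftrightarrow> True"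
| "admissible Fq Fh \<alpha> vs (Sq_Full i) \<longleftrightarrow> True"
| "admissible Fq Fh \<alpha> vs (Mul_Base i j) \<longleftrightarrow> vs ! i \<in> Fq \<and> vs ! j \<in> Fq"
| "admissible Fq Fh \<alpha> vs (Sq_Base i) \<longleftrightarrow> vs ! i \<in> Fq"
| "admissible Fq Fh \<alpha> vs (Mul_Base_Half i j) \<longleftrightarrow>
     vs ! i \<in> Fq \<and> vs ! j \<in> Fh \<union> (\<lambda>x. x * \<alpha>) ` Fh"
| "admissible Fq Fh \<alpha> vs (Mul_Const_a i) \<longleftrightarrow> vs ! i \<in> Fq"
| "admissible Fq Fh \<alpha> vs (Mul_Const_b i) \<longleftrightarrow> vs ! i \<in> Fq"

primrec result :: "'a::field \<Rightarrow> 'a \<Rightarrow> 'a list \<Rightarrow> operation \<Rightarrow> 'a" where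
  "result a b vs (Add i j) = vs ! i + vs ! j"
| "result a b vs (Sub i j) = vs ! i - vs ! j"
| "result a b vs (Mul_Full i j) = vs ! i * vs ! j"
| "result a b vs (Sq_Full i) = (vs ! i)^2"
| "result a b vs (Mul_Base i j) = vs ! i * vs ! j"
| "result a b vs (Sq_Base i) = (vs ! i)^2"
| "result a b vs (Mul_Base_Half i j) = vs ! i * vs ! j"
| "result a b vs (Mul_Const_a i) = a * vs ! i"
| "result a b vs (Mul_Const_b i) = b * vs ! i"

fun run :: "'a::field set \<Rightarrow> 'a set \<Rightarrow> 'a \<Rightarrow> 'a \<Rightarrow> 'a \<Rightarrow> operation list \<Rightarrow> 'a list \<Rightarrow> 'a list option"
where
  "run Fq Fh \<alpha> a b [] vs = Some vs"
| "run Fq Fh \<alpha> a b (c # cs) vs =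
     (if (\<forall>i\<in>set (arguments c). i < length vs) \<and> admissible Fq Fh \<alpha> vs c
      then run Fq Fh \<alpha> a b cs (vs @ [result a b vs c]) else None)"

text \<open>The cost units M, S, m, s, c.\<close>

datatype cost_unit = Cost_M | Cost_S | Cost_m | Cost_s | Cost_c

primrec op_cost :: "nat \<Rightarrow> operation \<Rightarrow> cost_unit \<Rightarrow> nat" where
  "op_cost k (Add i j) = (\<lambda>_. 0)"
| "op_cost k (Sub i j) = (\<lambda>_. 0)"
| "op_cost k (Mul_Full i j) = (\<lambda>_. 0)(Cost_M := 1)"
| "op_cost k (Sq_Full i) = (\<lambda>_. 0)(Cost_S := 1)"
| "op_cost k (Mul_Base i j) = (\<lambda>_. 0)(Cost_m := 1)"
| "op_cost k (Sq_Base i) = (\<lambda>_. 0)(Cost_s := 1)"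
| "op_cost k (Mul_Base_Half i j) = (\<lambda>_. 0)(Cost_m := k div 2)"
| "op_cost k (Mul_Const_a i) = (\<lambda>_. 0)(Cost_c := 1)"
| "op_cost k (Mul_Const_b i) = (\<lambda>_. 0)(Cost_c := 1)"

definition cost :: "nat \<Rightarrow> operation list \<Rightarrow> cost_unit \<Rightarrow> nat" where
  "cost k cs t = (\<Sum>c\<leftarrow>cs. op_cost k c t)"

text \<open>
  The program cs performs the doubling step for the points of order r over Fq, where v are
  coordinates of Q. The list pre holds the precomputed values; they may depend on P and Q but not
  on the current point R = (X : Y : Z) or the current value f. Every current point of the Miller
  loop is a multiple of P by an integer strictly between 0 and r; as r is prime, it is a point of
  order r over Fq.
\<close>

definition performs_doubling_step ::
  "'a::field set \<Rightarrow> 'a set \<Rightarrow> 'a \<Rightarrow> 'a \<Rightarrow> 'a \<Rightarrow> nat \<Rightarrow> 'a triple \<Rightarrow> operation list \<Rightarrow> bool" where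
  "performs_doubling_step Fq Fh \<alpha> a b r v cs \<longleftrightarrow>
     (\<exists>pre iX iY iZ i_f. \<forall>R X Y Z f.
        R \<in> huff_points Fq a b \<and> has_order a b R r \<and> is_coords Fq R (X, Y, Z) \<longrightarrow>
        (\<exists>vs. run Fq Fh \<alpha> a b cs ([X, Y, Z, f] @ pre) = Some vs \<and>
           {iX, iY, iZ, i_f} \<subseteq> {..<length vs} \<and>
           is_coords Fq (huff_add a b R R) (vs ! iX, vs ! iY, vs ! iZ) \<and>
           (\<exists>w\<in>Fh - {0}. vs ! i_f = w * (f^2 * miller_g Fq a b R R v))))"

end

(*
  On the tangent line at R = (x : y : z), the cubic form vanishes doubly on the line joining R
  and O. Projecting from O, what remains of it is the linear factor x^2 A^2 W2 - y^2 B^2 W1 with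
  A = a y^2 + z^2 and B = b x^2 + z^2, so that
    2R = (2 z x^2 A^2 : 2 z y^2 B^2 : x A B (z^2 - a y^2)).
  This has no exceptional cases except O and the points of order 2. By the curve equation, x y
  times the tangent form has the coefficients - y^2 B, x^2 A and 2 x y z (y - x), which shares
  x^2 A and y^2 B with the coordinates of 2R. The vertical line through 2R takes at Q a value
  in the half field, nonzero because Q is not defined over the base field.
*)

theory Submission
  imports Defs
begin

section \<open>Points and linear forms of the projective plane\<close>

lemma parallelI:
  fixes p1 p2 p3 q1 q2 q3 :: "'a::field"
  assumes "(q1, q2, q3) \<noteq> (0, 0, 0)"
    and "p1 * q2 = p2 * q1" "p2 * q3 = p3 * q2" "p1 * q3 = p3 * q1"
  shows "\<exists>c. (p1, p2, p3) = scale c (q1, q2, q3)"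
proof -
  consider "q1 \<noteq> 0" | "q2 \<noteq> 0" | "q3 \<noteq> 0" using assms(1) by auto
  then show ?thesis
  proof cases
    case 1 then show ?thesis using assms by (intro exI[of _ "p1 / q1"]) (auto simp: field_simps)
  next
    case 2 then show ?thesis using assms by (intro exI[of _ "p2 / q2"]) (auto simp: field_simps)
  next
    case 3 then show ?thesis using assms by (intro exI[of _ "p3 / q3"]) (auto simp: field_simps)
  qed
qed

text \<open>Both forms are proportional to the cross product of the two points.\<close>

lemma line_unique:
  fixes l m u v :: "'a::field triple"
  assumes l: "l \<noteq> (0, 0, 0)" and u: "u \<noteq> (0, 0, 0)" and v: "v \<notin> range (\<lambda>c. scale c u)"
    and "lin l u = 0" "lin l v = 0" "lin m u = 0" "lin m v = 0"
  shows "\<exists>c. m = scale c l"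
proof -
  obtain u1 u2 u3 v1 v2 v3 where uv: "u = (u1, u2, u3)" "v = (v1, v2, v3)"
    by (metis prod_cases3)
  define n1 n2 n3 where n: "n1 = u2 * v3 - u3 * v2" "n2 = u3 * v1 - u1 * v3" "n3 = u1 * v2 - u2 * v1"
  have n0: "(n1, n2, n3) \<noteq> (0, 0, 0)"
  proof
    assume "(n1, n2, n3) = (0, 0, 0)"
    then have "\<exists>c. (v1, v2, v3) = scale c (u1, u2, u3)"
      using u uv by (intro parallelI) (auto simp: n algebra_simps)
    with v uv show False by auto
  qed
  have *: "\<exists>c. k = scale c (n1, n2, n3)" if "lin k u = 0" "lin k v = 0" for k
  proof -
    obtain k1 k2 k3 where k: "k = (k1, k2, k3)" by (metis prod_cases3)
    have eq: "k1 * u1 + k2 * u2 + k3 * u3 = 0" "k1 * v1 + k2 * v2 + k3 * v3 = 0"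
      using that k uv by auto
    have "k1 * n2 = k2 * n1" "k2 * n3 = k3 * n2" "k1 * n3 = k3 * n1"
      using eq unfolding n by algebra+
    then show ?thesis unfolding k using n0 by (intro parallelI) auto
  qed
  from *[of l] assms obtain c where c: "l = scale c (n1, n2, n3)" by blast
  from *[of m] assms obtain d where d: "m = scale d (n1, n2, n3)" by blast
  have "c \<noteq> 0" using l c by auto
  then have "m = scale (d / c) l" by (simp add: c d)
  then show ?thesis ..
qed

lemma lin_commute: "lin u v = lin v u"
  by (cases u; cases v) (simp add: mult.commute)

lemma lin_scale_left: "lin (scale c l) u = c * lin l u"
  by (cases u; cases l) (simp add: algebra_simps)

lemma lin_scale_right: "lin l (scale c u) = c * lin l u"
  by (cases u; cases l) (simp add: algebra_simps)

lemma scale_scale: "scale c (scale d u) = scale (c * d) u"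
  by (cases u) (simp add: mult.assoc)

lemma scale_one: "scale 1 u = u"
  by (cases u) simp

lemma mem_pt_self: "u \<in> pt u"
  unfolding pt_def using scale_one[of u] by (metis (mono_tags, lifting) CollectI one_neq_zero)

lemma pt_scale:
  assumes "c \<noteq> 0"
  shows "pt (scale c u) = pt u"
proof
  show "pt (scale c u) \<subseteq> pt u"
    unfolding pt_def scale_scale using assms by force
  show "pt u \<subseteq> pt (scale c u)"
  proof
    fix v assume "v \<in> pt u"
    then obtain d where "d \<noteq> 0" "v = scale (d / c) (scale c u)"
      using assms by (auto simp: pt_def scale_scale)
    then show "v \<in> pt (scale c u)" using assms unfolding pt_def by force
  qed
qed

lemma pt_eq_iff: "pt u = pt v \<longleftrightarrow> (\<exists>c. c \<noteq> 0 \<and> u = scale c v)"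
proof
  assume "pt u = pt v"
  then have "u \<in> pt v" using mem_pt_self by blast
  then show "\<exists>c. c \<noteq> 0 \<and> u = scale c v" by (auto simp: pt_def)
qed (auto simp: pt_scale)

lemma pt_eq_iff': 
  assumes "u \<noteq> (0, 0, 0)"
  shows "pt u = pt v \<longleftrightarrow> u \<in> range (\<lambda>c. scale c v)"
  using assms by (cases v) (auto simp: pt_eq_iff)

lemma huff_scale: "huff a b (scale c u) = c ^ 3 * huff a b u"
  by (cases u) (simp add: algebra_simps power2_eq_square power3_eq_cube)

lemma huff_diagonal: "huff a b (x, x, z) = (a - b) * x ^ 3"
  by (simp add: algebra_simps power2_eq_square power3_eq_cube)

lemma huff_grad_scale: "huff_grad a b (scale c u) = scale (c\<^sup>2) (huff_grad a b u)"
  by (cases u) (simp add: algebra_simps power2_eq_square)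

text \<open>\<open>line_meets\<close> tests multiplicities along directions \<open>v\<close>, so
  without a second point on the line its condition at \<open>u\<close> would be vacuous. Three
  obvious vectors are killed by \<open>l\<close>; were they all multiples of \<open>u\<close>, their
  minors would vanish, and these include the squares of the coefficients of
  \<open>l\<close>.\<close>

lemma ex_second_point:
  fixes l u :: "'a::field triple"
  assumes l: "l \<noteq> (0, 0, 0)"
  shows "\<exists>v. v \<notin> range (\<lambda>c. scale c u) \<and> lin l v = 0"
proof (rule ccontr)
  assume neg: "\<not> ?thesis"
  obtain l1 l2 l3 where l': "l = (l1, l2, l3)" by (metis prod_cases3)
  obtain u1 u2 u3 where u: "u = (u1, u2, u3)" by (metis prod_cases3)
  have "lin l (l2, -l1, 0) = 0" "lin l (0, l3, -l2) = 0" "lin l (l3, 0, -l1) = 0"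
    by (simp_all add: l' algebra_simps)
  with neg obtain c d e where
    "(l2, -l1, 0) = scale c u" "(0, l3, -l2) = scale d u" "(l3, 0, -l1) = scale e u"
    by (metis imageE)
  then have eqs: "l2 = c * u1" "- l1 = c * u2" "0 = c * u3" "0 = d * u1" "l3 = d * u2"
     "- l2 = d * u3" "l3 = e * u1" "0 = e * u2" "- l1 = e * u3"
    by (simp_all add: u)
  have "l2 * l2 = 0" "l1 * l1 = 0" "l3 * l3 = 0" using eqs by algebra+
  then show False using l l' by simp
qed

section \<open>Uniqueness of intersection cycles and of third points\<close>

lemma line_meets_scale:
  assumes "c \<noteq> 0"
  shows "line_meets a b (scale c l) D \<longleftrightarrow> line_meets a b l D"
  using assms by (simp add: line_meets_def lin_scale_left)

text \<open>On the line, the order of vanishing fixes each multiplicity; off the line, the first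
  clause of \<open>line_meets\<close> forces it to be 0.\<close>

lemma line_meets_unique:
  assumes l: "l \<noteq> (0, 0, 0)" and D: "line_meets a b l D" and D': "line_meets a b l D'"
  shows "D = D'"
proof (rule multiset_eqI)
  fix T
  show "count D T = count D' T"
  proof (cases "\<exists>u. u \<noteq> (0, 0, 0) \<and> lin l u = 0 \<and> T = pt u")
    case True
    then obtain u where u: "u \<noteq> (0, 0, 0)" "lin l u = 0" "T = pt u" by blast
    obtain v where "v \<notin> range (\<lambda>c. scale c u)" "lin l v = 0" using ex_second_point[OF l] by blast
    with u D D' show ?thesis unfolding line_meets_def by metis
  next
    case False
    then have "T \<notin># D" "T \<notin># D'" using D D' unfolding line_meets_def by blast+
    then show ?thesis by (simp add: not_in_iff)
  qed
qed

text \<open>The gradient is quadratic, so changing the coordinates of a point only rescales its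
  tangent form by a square. For distinct points the line is determined by incidence.\<close>

lemma line_through_unique:
  assumes R1: "R1 = pt u1" "u1 \<noteq> (0, 0, 0)" and R2: "R2 = pt u2" "u2 \<noteq> (0, 0, 0)"
    and l: "line_through a b R1 R2 l" and m: "line_through a b R1 R2 m"
  shows "\<exists>c. c \<noteq> 0 \<and> m = scale c l"
proof -
  have nz: "l \<noteq> (0, 0, 0)" "m \<noteq> (0, 0, 0)" using l m by (auto simp: line_through_def)
  have "\<exists>c. m = scale c l"
  proof (cases "R1 = R2")
    case True
    obtain u c v d where *: "u \<in> R1" "l = scale c (huff_grad a b u)"
      "v \<in> R1" "m = scale d (huff_grad a b v)"
      using l m True unfolding line_through_def by metis
    obtain e f where ef: "e \<noteq> 0" "u = scale e u1" "v = scale f u1"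
      using *(1,3) R1 by (auto simp: pt_def)
    have c0: "c \<noteq> 0" using nz * by (cases "huff_grad a b u") auto
    have "m = scale (d * f\<^sup>2 / (c * e\<^sup>2)) l"
      using ef c0 by (simp add: * huff_grad_scale scale_scale)
    then show ?thesis ..
  next
    case False
    then have "u2 \<notin> range (\<lambda>c. scale c u1)" using R1 R2 pt_eq_iff'[of u2 u1] by auto
    moreover have "lin l u1 = 0" "lin l u2 = 0" "lin m u1 = 0" "lin m u2 = 0"
      using l m False R1 R2 mem_pt_self[of u1] mem_pt_self[of u2] unfolding line_through_def
      by (metis UnI1 UnI2)+
    ultimately show ?thesis using line_unique[of l u1 u2 m] nz R1 by blast
  qed
  then obtain c where c: "m = scale c l" ..
  then have "c \<noteq> 0" using nz by (cases l) auto
  with c show ?thesis by blast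
qed

text \<open>This removes the definite description: one line together with one cycle identifies the
  third point, because two cycles of the same line agree and the common points cancel.\<close>

lemma third_point_eqI:
  assumes R1: "R1 = pt u1" "u1 \<noteq> (0, 0, 0)" and R2: "R2 = pt u2" "u2 \<noteq> (0, 0, 0)"
    and l: "line_through a b R1 R2 l" and meets: "line_meets a b l {#R1, R2, R3#}"
  shows "third_point a b R1 R2 = R3"
  unfolding third_point_def
proof (rule the_equality)
  show "\<exists>l. line_through a b R1 R2 l \<and> line_meets a b l {#R1, R2, R3#}"
    using l meets by blast
next
  fix R assume "\<exists>l. line_through a b R1 R2 l \<and> line_meets a b l {#R1, R2, R#}"
  then obtain m where m: "line_through a b R1 R2 m" "line_meets a b m {#R1, R2, R#}" by blast
  obtain c where "c \<noteq> 0" "m = scale c l" using line_through_unique[OF R1 R2 l m(1)] by blast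
  with m have "line_meets a b l {#R1, R2, R#}" by (simp add: line_meets_scale)
  moreover have "l \<noteq> (0, 0, 0)" using l by (simp add: line_through_def)
  ultimately have "{#R1, R2, R#} = {#R1, R2, R3#}" using meets line_meets_unique by blast
  then show "R = R3" by simp
qed

text \<open>Lifting the coefficients to constant polynomials allows a form to be evaluated at the
  moving point u + t v, whose coordinates are polynomials in t.\<close>

fun const_triple :: "'a::field triple \<Rightarrow> 'a poly triple" where
  "const_triple (x, y, z) = ([:x:], [:y:], [:z:])"

lemma order_0_linear_poly:
  fixes c d :: "'a::field"
  assumes "[:c, d:] \<noteq> 0"
  shows "order 0 [:c, d:] = (if c = 0 then 1 else 0)"
proof (cases "c = 0")
  case True
  then have "[:c, d:] = smult d ([:- 0, 1:] ^ 1)" "d \<noteq> 0" using assms by auto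
  then show ?thesis using True by (metis order_power_n_n order_smult)
next
  case False
  then show ?thesis by (simp add: order_0I)
qed

text \<open>The identity is required for polynomials because over a finite field the values of a form
  do not determine its order of vanishing.\<close>

lemma line_meetsI:
  fixes a b c :: "'a::field"
  assumes l: "l \<noteq> (0, 0, 0)" and c: "c \<noteq> 0"
    and t: "t1 \<noteq> (0, 0, 0)" "t2 \<noteq> (0, 0, 0)" "t3 \<noteq> (0, 0, 0)"
    and lt: "lin l t1 = 0" "lin l t2 = 0" "lin l t3 = 0"
    and mt: "lin m1 t1 = 0" "lin m2 t2 = 0" "lin m3 t3 = 0"
    and ml: "m1 \<notin> range (\<lambda>c. scale c l)" "m2 \<notin> range (\<lambda>c. scale c l)" "m3 \<notin> range (\<lambda>c. scale c l)"
    and id: "\<And>W. lin (const_triple l) W = 0 \<Longrightarrow> smult c (huff [:a:] [:b:] W) =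
      lin (const_triple m1) W * lin (const_triple m2) W * lin (const_triple m3) W"
  shows "line_meets a b l {#pt t1, pt t2, pt t3#}"
  unfolding line_meets_def
proof (intro conjI allI impI ballI)
  fix T assume "T \<in># {#pt t1, pt t2, pt t3#}"
  then show "\<exists>u. u \<noteq> (0, 0, 0) \<and> lin l u = 0 \<and> T = pt u" using t lt
    by (auto simp del: split_paired_Ex)
next
  fix u v
  assume "u \<noteq> (0, 0, 0) \<and> v \<notin> range (\<lambda>c. scale c u) \<and> lin l u = 0 \<and> lin l v = 0"
  then have u: "u \<noteq> (0, 0, 0)" "lin l u = 0" and v: "v \<notin> range (\<lambda>c. scale c u)" "lin l v = 0"
    by auto
  \<comment> \<open>As \<open>m\<close> is not a multiple of \<open>l\<close> (in particular not 0),
    the two forms vanish together at \<open>pt t\<close> only. Along u + t v the form is therefore a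
    nonzero polynomial of degree at most 1, with a root at 0 exactly if \<open>u\<close> represents
    \<open>pt t\<close>.\<close>
  have factor: "[:lin m u, lin m v:] \<noteq> 0 \<and>
      order 0 [:lin m u, lin m v:] = (if pt t = pt u then 1 else 0)"
    if "t \<noteq> (0, 0, 0)" "lin l t = 0" "lin m t = 0" "m \<notin> range (\<lambda>c. scale c l)" for m t
  proof -
    have ker: "w \<in> range (\<lambda>c. scale c t)" if "lin l w = 0" "lin m w = 0" for w
      using line_unique[of t l m w] that l \<open>t \<noteq> (0, 0, 0)\<close> \<open>lin l t = 0\<close> \<open>lin m t = 0\<close>
        \<open>m \<notin> range (\<lambda>c. scale c l)\<close>
      by (auto simp: lin_commute)
    have iff: "lin m u = 0 \<longleftrightarrow> pt t = pt u"
    proof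
      assume "lin m u = 0"
      then show "pt t = pt u" using ker u pt_eq_iff' by metis
    next
      assume "pt t = pt u"
      then obtain d where "u = scale d t" using pt_eq_iff by metis
      then show "lin m u = 0" using that by (simp add: lin_scale_right)
    qed
    have "[:lin m u, lin m v:] \<noteq> 0"
    proof
      assume "[:lin m u, lin m v:] = 0"
      then have z: "lin m u = 0" "lin m v = 0" by auto
      obtain d where "u = scale d t" using ker u z by blast
      moreover obtain e where "v = scale e t" using ker v z by blast
      moreover have "d \<noteq> 0" using u \<open>u = scale d t\<close> by (cases t) auto
      ultimately have "v = scale (e / d) u" by (simp add: scale_scale)
      with v show False by blast
    qed
    with iff show ?thesis by (simp add: order_0_linear_poly)
  qed
  obtain u1 u2 u3 v1 v2 v3 where uv: "u = (u1, u2, u3)" "v = (v1, v2, v3)"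
    by (metis prod_cases3)
  have lin_along: "lin (const_triple m) ([:u1, v1:], [:u2, v2:], [:u3, v3:]) = [:lin m u, lin m v:]"
    for m by (cases m) (simp add: uv)
  define G where "G m = [:lin m u, lin m v:]" for m
  have prod: "smult c (huff_along a b u v) = G m1 * G m2 * G m3"
    using id[of "([:u1, v1:], [:u2, v2:], [:u3, v3:])"] u v
    by (simp only: lin_along) (simp add: uv G_def)
  have f: "G m1 \<noteq> 0" "G m2 \<noteq> 0" "G m3 \<noteq> 0"
    "order 0 (G m1) = (if pt t1 = pt u then 1 else 0)"
    "order 0 (G m2) = (if pt t2 = pt u then 1 else 0)"
    "order 0 (G m3) = (if pt t3 = pt u then 1 else 0)"
    using factor t lt mt ml by (auto simp: G_def)
  then have nz: "G m1 * G m2 * G m3 \<noteq> 0" "G m1 * G m2 \<noteq> 0" by auto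
  show "huff_along a b u v \<noteq> 0" using prod nz by auto
  have "order 0 (huff_along a b u v) = order 0 (G m1 * G m2 * G m3)"
    using c prod order_smult by metis
  also have "\<dots> = count {#pt t1, pt t2, pt t3#} (pt u)"
    using nz f by (simp add: order_mult)
  finally show "order 0 (huff_along a b u v) = count {#pt t1, pt t2, pt t3#} (pt u)" .
qed

section \<open>Lines through O, points of order two and exceptional coordinates\<close>

lemma huff_points_coords:
  assumes "pt u \<in> huff_points F a b"
  shows "huff a b u = 0"
proof -
  obtain v where "pt u = pt v" "huff a b v = 0"
    using assms unfolding huff_points_def by blast
  moreover then obtain c where "u = scale c v" using pt_eq_iff by blast
  ultimately show ?thesis by (simp add: huff_scale del: huff.simps)
qed

text \<open>O is an inflection point: on its tangent W1 = W2 the cubic form reduces to (a - b)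
  W1^3.\<close>

lemma third_point_O_O:
  fixes a b :: "'a::field"
  assumes "a \<noteq> b"
  shows "third_point a b huff_O huff_O = huff_O"
proof -
  have "line_meets a b (-1, 1, 0) {#pt (0, 0, 1), pt (0, 0, 1), pt (0, 0, 1)#}"
  proof (rule line_meetsI[where c = 1 and ?m1.0 = "(a - b, 0, 0)" and ?m2.0 = "(1, 0, 0)"
        and ?m3.0 = "(1, 0, 0)"])
    fix W :: "'a poly triple"
    obtain W1 W2 W3 where W: "W = (W1, W2, W3)" by (metis prod_cases3)
    assume "lin (const_triple (-1, 1, 0)) W = 0"
    then have "W2 = W1" by (simp add: W one_pCons[symmetric])
    then show "smult 1 (huff [:a:] [:b:] W) = lin (const_triple (a - b, 0, 0)) W *
        lin (const_triple (1, 0, 0)) W * lin (const_triple (1, 0, 0)) W"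
      by (simp add: W power2_eq_square algebra_simps smult_diff_left)
  qed (use assms in auto)
  moreover have "line_through a b (pt (0, 0, 1)) (pt (0, 0, 1)) (-1, 1, 0)"
    using mem_pt_self[of "(0, 0, 1)"] by (auto simp: line_through_def intro!: bexI exI[of _ 1])
  ultimately show ?thesis
    unfolding huff_O_def by (intro third_point_eqI[OF refl _ refl]) auto
qed

text \<open>On the line joining O and the point, W1 = x V and W2 = y V, and by the curve equation
  the cubic form becomes (y - x) V (W3^2 - z^2 V^2). The case z = 0, where two of the intersections
  coincide, is included.\<close>

lemma line_meets_vertical:
  fixes a b x y z :: "'a::field"
  assumes ab: "a \<noteq> b" and curve: "huff a b (x, y, z) = 0" and xy: "(x, y) \<noteq> (0, 0)"
  shows "line_meets a b (y, - x, 0) {#pt (0, 0, 1), pt (x, y, z), pt (x, y, - z)#}"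
proof -
  have cv: "x * (a * y\<^sup>2 - z\<^sup>2) - y * (b * x\<^sup>2 - z\<^sup>2) = 0" using curve by simp
  have ne: "y \<noteq> x"
  proof
    assume "y = x"
    then show False using huff_diagonal[of a b x z] curve ab xy by simp
  qed
  \<comment> \<open>With these coefficients the parameter is the linear form V = s W1 + t W2,
    whichever of \<open>x\<close> and \<open>y\<close> is nonzero.\<close>
  obtain s t where st: "s * x + t * y = 1"
  proof (cases "x = 0")
    case True then show ?thesis using xy that[of 0 "1 / y"] by auto
  next
    case False then show ?thesis using that[of "1 / x" 0] by auto
  qed
  show ?thesis
  proof (rule line_meetsI[where c = 1 and ?m1.0 = "((y - x) * s, (y - x) * t, 0)"
        and ?m2.0 = "(- z * s, - z * t, 1)" and ?m3.0 = "(z * s, z * t, 1)"])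
    fix W :: "'a poly triple"
    obtain W1 W2 W3 where W: "W = (W1, W2, W3)" by (metis prod_cases3)
    define X Y Z A B S T where defs: "X = [:x:]" "Y = [:y:]" "Z = [:z:]" "A = [:a:]" "B = [:b:]"
      "S = [:s:]" "T = [:t:]"
    assume "lin (const_triple (y, - x, 0)) W = 0"
    then have l: "Y * W1 = X * W2" by (simp add: W defs)
    have one: "S * X + T * Y = 1" using st by (simp add: defs one_pCons mult.commute)
    have cvp: "X * (A * Y\<^sup>2 - Z\<^sup>2) - Y * (B * X\<^sup>2 - Z\<^sup>2) = 0"
      using cv by (simp add: defs power2_eq_square algebra_simps)
    define V where "V = S * W1 + T * W2"
    have "W1 = X * V" "W2 = Y * V" using l one unfolding V_def by algebra+
    then have "huff A B (W1, W2, W3) = (Y - X) * V * (W3 - Z * V) * (W3 + Z * V)"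
      using cvp unfolding huff.simps by algebra
    then show "smult 1 (huff [:a:] [:b:] W) = lin (const_triple ((y - x) * s, (y - x) * t, 0)) W *
        lin (const_triple (- z * s, - z * t, 1)) W * lin (const_triple (z * s, z * t, 1)) W"
      by (simp add: W V_def defs algebra_simps smult_diff_left)
  next
    have *: "- z * s * x + - z * t * y + z = 0" using st by algebra
    then show "lin (- z * s, - z * t, 1) (x, y, z) = 0" by simp
    have "z * s * x + z * t * y + - z = 0" using st by algebra
    then show "lin (z * s, z * t, 1) (x, y, - z) = 0" by simp
    show "((y - x) * s, (y - x) * t, 0) \<notin> range (\<lambda>c. scale c (y, - x, 0))"
    proof
      assume "((y - x) * s, (y - x) * t, 0) \<in> range (\<lambda>c. scale c (y, - x, 0))"
      then obtain c where "(y - x) * s = c * y" "(y - x) * t = - (c * x)" by auto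
      then have "(y - x) * (s * x + t * y) = 0" by algebra
      with st ne show False by simp
    qed
  qed (use xy in auto)
qed

text \<open>Consequently the last step of \<open>huff_add\<close> is only a change of sign of the
  third coordinate.\<close>

lemma third_point_O:
  fixes a b x y z :: "'a::field"
  assumes ab: "a \<noteq> b" and curve: "huff a b (x, y, z) = 0" and xy: "(x, y) \<noteq> (0, 0)"
  shows "third_point a b huff_O (pt (x, y, z)) = pt (x, y, - z)"
proof -
  have "pt (0, 0, 1) \<noteq> pt (x, y, z)" using xy by (auto simp: pt_eq_iff)
  then have "line_through a b (pt (0, 0, 1)) (pt (x, y, z)) (y, - x, 0)"
    using xy by (auto simp: line_through_def pt_def)
  then show ?thesis
    unfolding huff_O_def using line_meets_vertical[OF assms] xy
    by (intro third_point_eqI[OF refl _ refl]) auto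
qed

lemma huff_add_O_O: "a \<noteq> b \<Longrightarrow> huff_add a b huff_O huff_O = huff_O"
  by (simp add: huff_add_def third_point_O_O)

lemma huff_add_O:
  assumes "a \<noteq> b" "huff a b (x, y, z) = 0" "(x, y) \<noteq> (0, 0)"
  shows "huff_add a b huff_O (pt (x, y, z)) = pt (x, y, z)"
  using assms third_point_O[of a b x y z] third_point_O[of a b x y "-z"]
  by (simp add: huff_add_def)

text \<open>At a point with third coordinate 0 the tangent is the line through O, which meets the
  curve twice there and once at O.\<close>

lemma huff_double_infinity:
  fixes a b x y :: "'a::field"
  assumes ab: "a * b * (a - b) \<noteq> 0" and curve: "huff a b (x, y, 0) = 0" and xy: "(x, y) \<noteq> (0, 0)"
  shows "huff_add a b (pt (x, y, 0)) (pt (x, y, 0)) = huff_O"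
proof -
  have ne: "a \<noteq> b" "a \<noteq> 0" "b \<noteq> 0" using ab by auto
  define g where "g = huff_grad a b (x, y, 0)"
  have cv: "x * y * (a * y - b * x) = 0" using curve by (simp add: power2_eq_square algebra_simps)
  \<comment> \<open>This is Euler's relation: the gradient kills the point itself. Since its last
    entry is 0 as well, it must be a multiple of (y, - x, 0).\<close>
  have cv': "(a * y\<^sup>2 - 2 * b * x * y) * - x = (2 * a * x * y - b * x\<^sup>2) * y" using cv by algebra
  have g: "g = (a * y\<^sup>2 - 2 * b * x * y, 2 * a * x * y - b * x\<^sup>2, 0)" by (simp add: g_def)
  have "\<exists>c. g = scale c (y, - x, 0)"
    unfolding g using xy cv' by (intro parallelI) auto
  then obtain c where c: "g = scale c (y, - x, 0)" ..
  have g0: "g \<noteq> (0, 0, 0)"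
  proof
    assume "g = (0, 0, 0)"
    then have e: "a * y\<^sup>2 - 2 * b * x * y = 0" "2 * a * x * y - b * x\<^sup>2 = 0" by (auto simp: g)
    have "x \<noteq> 0" using e xy ne by auto
    moreover have "y \<noteq> 0" using e xy ne by auto
    ultimately have "a * y = b * x" using cv by auto
    then have "(b * x) * y = 0" using e(1) by algebra
    with ne \<open>x \<noteq> 0\<close> \<open>y \<noteq> 0\<close> show False by simp
  qed
  then have c0: "c \<noteq> 0" using c by auto
  have "line_through a b (pt (x, y, 0)) (pt (x, y, 0)) g"
    using g0 mem_pt_self[of "(x, y, 0)"]
    by (auto simp: line_through_def g_def intro!: bexI[of _ "(x, y, 0)"] exI[of _ 1])
  moreover have "line_meets a b g {#pt (x, y, 0), pt (x, y, 0), pt (0, 0, 1)#}"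
    using line_meets_vertical[OF ne(1) curve xy] c0
    unfolding c by (simp add: line_meets_scale add_mset_commute del: scale.simps)
  ultimately have "third_point a b (pt (x, y, 0)) (pt (x, y, 0)) = pt (0, 0, 1)"
    using xy by (intro third_point_eqI[OF refl _ refl]) auto
  then show ?thesis
    using third_point_O_O[OF ne(1)] by (simp add: huff_add_def huff_O_def)
qed

text \<open>These inequalities are what the doubling formula requires. Order above 2 excludes O and
  the points with z = 0; the curve equation gives the rest.\<close>

lemma odd_order_coords:
  fixes a b x y z :: "'a::field"
  assumes ab: "a * b * (a - b) \<noteq> 0" and curve: "huff a b (x, y, z) = 0"
    and nz: "(x, y, z) \<noteq> (0, 0, 0)" and order: "has_order a b (pt (x, y, z)) r" and r: "r > 2"
  shows "x \<noteq> 0" "y \<noteq> 0" "z \<noteq> 0" "x \<noteq> y"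
proof -
  have ne: "a \<noteq> b" using ab by auto
  \<comment> \<open>\<open>huff_mult\<close> starts from O, so the multiples by 1 and 2 are sums
    beginning with \<open>huff_O\<close>.\<close>
  have m1: "huff_add a b huff_O (pt (x, y, z)) \<noteq> huff_O"
    using order r unfolding has_order_def
    by (metis One_nat_def huff_mult.simps less_trans one_less_numeral_iff semiring_norm(76) zero_less_one)
  have m2: "huff_add a b (huff_add a b huff_O (pt (x, y, z))) (pt (x, y, z)) \<noteq> huff_O"
    using order r unfolding has_order_def
    by (metis huff_mult.simps numeral_2_eq_2 zero_less_Suc)
  have xy: "(x, y) \<noteq> (0, 0)"
  proof
    assume "(x, y) = (0, 0)"
    then have "pt (x, y, z) = huff_O"
      unfolding huff_O_def using nz by (auto simp: pt_eq_iff)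
    with m1 huff_add_O_O[OF ne] show False by simp
  qed
  then show z: "z \<noteq> 0"
    using m2 huff_double_infinity[OF ab, of x y] huff_add_O[OF ne, of x y z] curve by auto
  show "x \<noteq> 0" "y \<noteq> 0" using xy z curve by auto
  show "x \<noteq> y"
  proof
    assume "x = y"
    then show False using huff_diagonal[of a b x z] curve ne \<open>x \<noteq> 0\<close> by simp
  qed
qed

section \<open>The tangent line and the doubling formula\<close>

text \<open>Eliminating W3 by means of the tangent equation leaves a binary cubic form in W1 and W2
  with the double root (x : y). Integral domains are allowed because the identity is used both for
  field elements and for polynomials.\<close>

lemma tangent_cubic_identity:
  fixes a b x y z :: "'a::idom"
  assumes cv: "huff a b (x, y, z) = 0"
    and l: "lin (huff_grad a b (x, y, z)) (W1, W2, W3) = 0"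
  shows "(x * y * (2 * z * (y - x)))\<^sup>2 * huff a b (W1, W2, W3) =
    (y * W1 - x * W2) * (y * W1 - x * W2) *
    (x\<^sup>2 * (a * y\<^sup>2 + z\<^sup>2)\<^sup>2 * W2 - y\<^sup>2 * (b * x\<^sup>2 + z\<^sup>2)\<^sup>2 * W1)"
proof -
  define A B k where defs: "A = a * y\<^sup>2 + z\<^sup>2" "B = b * x\<^sup>2 + z\<^sup>2" "k = 2 * z * (y - x)"
  have cv': "x * (a * y\<^sup>2 - z\<^sup>2) - y * (b * x\<^sup>2 - z\<^sup>2) = 0" using cv by simp
  have l': "(a * y\<^sup>2 - z\<^sup>2 - 2 * b * x * y) * W1 + (2 * a * x * y - (b * x\<^sup>2 - z\<^sup>2)) * W2 + k * W3 = 0"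
    using l by (simp add: defs algebra_simps)
  have g1: "x * (a * y\<^sup>2 - z\<^sup>2 - 2 * b * x * y) = - (y * B)"
    using cv' unfolding defs by algebra
  have g2: "y * (2 * a * x * y - (b * x\<^sup>2 - z\<^sup>2)) = x * A"
    using cv' unfolding defs by algebra
  have W3: "x * y * k * W3 = y\<^sup>2 * B * W1 - x\<^sup>2 * A * W2"
    using l' g1 g2 by algebra
  \<comment> \<open>\<open>c1\<close> and \<open>c2\<close> compare the coefficients of W1^2 W2 and
    of W1 W2^2 on both sides; those of W1^3 and W2^3 agree at once.\<close>
  have c1: "y^4 * B\<^sup>2 + 2 * x\<^sup>2 * y\<^sup>2 * A * B - b * (x * y * k)\<^sup>2 = x\<^sup>2 * y\<^sup>2 * A\<^sup>2 + 2 * x * y^3 * B\<^sup>2"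
    using cv' unfolding defs by algebra
  have c2: "a * (x * y * k)\<^sup>2 - 2 * x\<^sup>2 * y\<^sup>2 * A * B - x^4 * A\<^sup>2 = - (2 * x^3 * y * A\<^sup>2) - x\<^sup>2 * y\<^sup>2 * B\<^sup>2"
    using cv' unfolding defs by algebra
  have "(x * y * k)\<^sup>2 * huff a b (W1, W2, W3) =
      (x * y * k)\<^sup>2 * (W1 * W2 * (a * W2 - b * W1)) + (W2 - W1) * (x * y * k * W3)\<^sup>2"
    by (simp add: algebra_simps power2_eq_square)
  also have "\<dots> = (y * W1 - x * W2) * (y * W1 - x * W2) * (x\<^sup>2 * A\<^sup>2 * W2 - y\<^sup>2 * B\<^sup>2 * W1)"
    unfolding W3 using c1 c2 by algebra
  finally show ?thesis by (simp only: defs)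
qed

text \<open>The first two entries are the root of the residual linear factor, scaled by 2 z. Solving
  the tangent equation for the third entry divides by 2 z (y - x): the scaling absorbs 2 z, and y (A
  - B) = (y - x) (a y^2 - z^2) on the curve absorbs y - x. The final sign change is the reflection
  through O.\<close>

fun double_coords :: "'a::comm_ring_1 \<Rightarrow> 'a \<Rightarrow> 'a triple \<Rightarrow> 'a triple" where
  "double_coords a b (x, y, z) =
     (2 * z * (x\<^sup>2 * (a * y\<^sup>2 + z\<^sup>2)\<^sup>2), 2 * z * (y\<^sup>2 * (b * x\<^sup>2 + z\<^sup>2)\<^sup>2),
      x * (a * y\<^sup>2 + z\<^sup>2) * (b * x\<^sup>2 + z\<^sup>2) * (z\<^sup>2 - a * y\<^sup>2))"

text \<open>If both A and B vanished, the curve equation would become 2 z^2 (y - x) = 0, but the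
  curve has no point with x = y nonzero.\<close>

lemma double_coords_xy_nonzero:
  fixes a b x y z :: "'a::field"
  assumes two: "(2::'a) \<noteq> 0" and ab: "a \<noteq> b" and cv: "huff a b (x, y, z) = 0"
    and nz: "x \<noteq> 0" "y \<noteq> 0" "z \<noteq> 0"
    and D: "double_coords a b (x, y, z) = (X, Y, Z)"
  shows "(X, Y) \<noteq> (0, 0)"
proof
  assume "(X, Y) = (0, 0)"
  then have A: "a * y\<^sup>2 + z\<^sup>2 = 0" and B: "b * x\<^sup>2 + z\<^sup>2 = 0" using D two nz by auto
  have "x * (a * y\<^sup>2 - z\<^sup>2) - y * (b * x\<^sup>2 - z\<^sup>2) = 0" using cv by simp
  then have "2 * z\<^sup>2 * (x - y) = 0" using A B by algebra
  then have "x = y" using two nz by simp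
  then show False using huff_diagonal[of a b x z] cv ab nz by simp
qed

lemma huff_double:
  fixes a b x y z :: "'a::field"
  assumes two: "(2::'a) \<noteq> 0" and ab: "a \<noteq> b" and cv: "huff a b (x, y, z) = 0"
    and nz: "x \<noteq> 0" "y \<noteq> 0" "z \<noteq> 0" "x \<noteq> y"
  shows "huff a b (double_coords a b (x, y, z)) = 0"
    and "huff_add a b (pt (x, y, z)) (pt (x, y, z)) = pt (double_coords a b (x, y, z))"
proof -
  obtain X Y Z where D: "double_coords a b (x, y, z) = (X, Y, Z)" by (metis prod_cases3)
  have XY: "(X, Y) \<noteq> (0, 0)" using double_coords_xy_nonzero[OF two ab cv nz(1-3) D] .
  define A B k p q where defs: "A = a * y\<^sup>2 + z\<^sup>2" "B = b * x\<^sup>2 + z\<^sup>2" "k = 2 * z * (y - x)"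
    "p = x\<^sup>2 * A\<^sup>2" "q = y\<^sup>2 * B\<^sup>2"
  have XYZ: "X = 2 * z * p" "Y = 2 * z * q" "Z = x * A * B * (z\<^sup>2 - a * y\<^sup>2)"
    using D by (simp_all add: defs)
  define g where "g = huff_grad a b (x, y, z)"
  define g1 g2 where g12: "g1 = a * y\<^sup>2 - z\<^sup>2 - 2 * b * x * y" "g2 = 2 * a * x * y - (b * x\<^sup>2 - z\<^sup>2)"
  have g: "g = (g1, g2, k)" by (simp add: g_def g12 defs algebra_simps)
  have k0: "k \<noteq> 0" using two nz by (simp add: defs)
  have cv': "x * (a * y\<^sup>2 - z\<^sup>2) - y * (b * x\<^sup>2 - z\<^sup>2) = 0" using cv by simp
  have gR: "g1 * x + g2 * y + k * z = 0"
    using cv' unfolding g12 defs by algebra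
  \<comment> \<open>The factor x y makes the curve equation applicable to the tangent coefficients;
    it is cancelled afterwards.\<close>
  have gD': "g1 * X + g2 * Y - k * Z = 0"
  proof -
    have "x * y * (g1 * X + g2 * Y - k * Z) = 0"
      using cv' unfolding g12 XYZ defs by algebra
    with nz show ?thesis by simp
  qed
  then have gD: "lin g (X, Y, - Z) = 0" by (simp add: g)
  \<comment> \<open>Being on the tangent and a root of the residual factor already puts the point on
    the curve.\<close>
  have "(x * y * k)\<^sup>2 * huff a b (X, Y, - Z) = 0"
    using tangent_cubic_identity[OF cv gD[unfolded g_def]]
    by (simp add: defs[symmetric] XYZ del: huff.simps)
  then have cD': "huff a b (X, Y, - Z) = 0" using k0 nz by simp
  then have cD: "huff a b (X, Y, Z) = 0" by simp
  then show "huff a b (double_coords a b (x, y, z)) = 0" using D by simp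
  have meets: "line_meets a b g {#pt (x, y, z), pt (x, y, z), pt (X, Y, - Z)#}"
  proof (rule line_meetsI[where c = "(x * y * k)\<^sup>2" and ?m1.0 = "(y, - x, 0)"
        and ?m2.0 = "(y, - x, 0)" and ?m3.0 = "(- q, p, 0)"])
    fix W :: "'a poly triple"
    obtain W1 W2 W3 where W: "W = (W1, W2, W3)" by (metis prod_cases3)
    assume "lin (const_triple g) W = 0"
    moreover have "const_triple g = huff_grad [:a:] [:b:] ([:x:], [:y:], [:z:])"
      by (simp add: g_def numeral_poly power2_eq_square)
    ultimately have l: "lin (huff_grad [:a:] [:b:] ([:x:], [:y:], [:z:])) (W1, W2, W3) = 0"
      by (simp only: W)
    have c: "huff [:a:] [:b:] ([:x:], [:y:], [:z:]) = 0"
      using cv by (simp add: power2_eq_square mult.commute)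
    have 1: "([:x:] * [:y:] * (2 * [:z:] * ([:y:] - [:x:])))\<^sup>2 = [:(x * y * k)\<^sup>2:]"
      by (simp add: numeral_poly power2_eq_square defs)
    have 2: "[:x:]\<^sup>2 * ([:a:] * [:y:]\<^sup>2 + [:z:]\<^sup>2)\<^sup>2 = [:p:]"
      by (simp add: power2_eq_square defs mult.commute)
    have 3: "[:y:]\<^sup>2 * ([:b:] * [:x:]\<^sup>2 + [:z:]\<^sup>2)\<^sup>2 = [:q:]"
      by (simp add: power2_eq_square defs mult.commute)
    show "smult ((x * y * k)\<^sup>2) (huff [:a:] [:b:] W) = lin (const_triple (y, - x, 0)) W *
        lin (const_triple (y, - x, 0)) W * lin (const_triple (- q, p, 0)) W"
      using tangent_cubic_identity[OF c l] unfolding 1 2 3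
      by (simp add: W del: huff.simps)
  next
    \<comment> \<open>The last coefficient is 0 here but \<open>k\<close>, which is nonzero, in
      \<open>g\<close>.\<close>
    show "(y, - x, 0) \<notin> range (\<lambda>c. scale c g)" using nz k0 by (auto simp: g)
    show "(y, - x, 0) \<notin> range (\<lambda>c. scale c g)" using nz k0 by (auto simp: g)
    show "(- q, p, 0) \<notin> range (\<lambda>c. scale c g)" using XY k0 XYZ by (auto simp: g)
  qed (use nz k0 XY XYZ gR gD in \<open>auto simp: g\<close>)
  have "line_through a b (pt (x, y, z)) (pt (x, y, z)) g"
    using k0 mem_pt_self[of "(x, y, z)"] scale_one[of g]
    unfolding line_through_def g_def[symmetric]
    by (metis g g_def Pair_inject)
  then have "third_point a b (pt (x, y, z)) (pt (x, y, z)) = pt (X, Y, - Z)"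
    using meets nz by (intro third_point_eqI[OF refl _ refl]) auto
  then show "huff_add a b (pt (x, y, z)) (pt (x, y, z)) = pt (double_coords a b (x, y, z))"
    using third_point_O[OF ab cD' XY] unfolding D by (simp add: huff_add_def)
qed

section \<open>Rationality of the line forms and nonvanishing at Q\<close>

lemma subfield_closed:
  assumes "subfield_of F"
  shows "0 \<in> F" "1 \<in> F"
    and "\<And>x y. x \<in> F \<Longrightarrow> y \<in> F \<Longrightarrow> x - y \<in> F"
    and "\<And>x y. x \<in> F \<Longrightarrow> y \<in> F \<Longrightarrow> x * y \<in> F"
    and "\<And>x. x \<in> F \<Longrightarrow> - x \<in> F"
    and "\<And>x y. x \<in> F \<Longrightarrow> y \<in> F \<Longrightarrow> x + y \<in> F"
    and "\<And>x y. x \<in> F \<Longrightarrow> y \<in> F \<Longrightarrow> x / y \<in> F"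
    and "\<And>x. x \<in> F \<Longrightarrow> x\<^sup>2 \<in> F"
proof -
  show 0: "0 \<in> F" and "1 \<in> F"
    and diff: "\<And>x y. x \<in> F \<Longrightarrow> y \<in> F \<Longrightarrow> x - y \<in> F"
    and mult: "\<And>x y. x \<in> F \<Longrightarrow> y \<in> F \<Longrightarrow> x * y \<in> F"
    using assms by (auto simp: subfield_of_def)
  show neg: "- x \<in> F" if "x \<in> F" for x using diff[OF 0 that] by simp
  show "x + y \<in> F" if "x \<in> F" "y \<in> F" for x y using diff[OF that(1) neg[OF that(2)]] by simp
  show "x / y \<in> F" if "x \<in> F" "y \<in> F" for x y
    using assms that mult by (auto simp: subfield_of_def divide_inverse)
  show "x\<^sup>2 \<in> F" if "x \<in> F" for x using mult that by (simp add: power2_eq_square)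
qed

text \<open>Whatever form the choice operator picks, it differs from the gradient by a constant of
  \<open>F\<close>: this constant is the quotient of the two last coefficients, both in
  \<open>F\<close>. Such a constant may be dropped from the Miller value.\<close>

lemma line_form_tangent:
  fixes a b x y z :: "'a::field"
  assumes F: "subfield_of F" and R: "a \<in> F" "b \<in> F" "x \<in> F" "y \<in> F" "z \<in> F"
    and nz: "2 * z * (y - x) \<noteq> 0"
  shows "\<exists>e\<in>F - {0}. line_form F a b (pt (x, y, z)) (pt (x, y, z)) = scale e (huff_grad a b (x, y, z))"
proof -
  note closed = subfield_closed[OF F]
  define g where "g = huff_grad a b (x, y, z)"
  obtain g1 g2 g3 where g: "g = (g1, g2, g3)" by (metis prod_cases3)
  have two: "2 \<in> F" using closed(6)[OF closed(2,2)] by simp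
  have gF: "g \<in> F \<times> F \<times> F" using R two by (auto simp: g_def intro!: closed)
  have g3: "g3 \<noteq> 0" "g3 \<in> F" using nz gF g by (auto simp: g_def algebra_simps)
  have l: "line_through a b (pt (x, y, z)) (pt (x, y, z)) g"
    using g3 g mem_pt_self[of "(x, y, z)"] scale_one[of g]
    unfolding line_through_def g_def[symmetric]
    by (metis g_def Pair_inject)
  define m where "m = line_form F a b (pt (x, y, z)) (pt (x, y, z))"
  have m: "m \<in> F \<times> F \<times> F" "line_through a b (pt (x, y, z)) (pt (x, y, z)) m"
    using someI[of "\<lambda>l. l \<in> F \<times> F \<times> F \<and> line_through a b (pt (x, y, z)) (pt (x, y, z)) l" g] gF l
    unfolding m_def line_form_def by blast+
  have "(x, y, z) \<noteq> (0, 0, 0)" using nz by auto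
  then obtain e where e: "e \<noteq> 0" "m = scale e g"
    using line_through_unique[OF refl _ refl _ l m(2)] by blast
  then have "e * g3 \<in> F" using m(1) g by auto
  then have "e * g3 / g3 \<in> F" using closed(7) g3 by blast
  then show ?thesis using e g3 by (auto simp: m_def g_def)
qed

lemma line_form_vertical:
  fixes a b X Y Z :: "'a::field"
  assumes F: "subfield_of F" and S: "X \<in> F" "Y \<in> F" and XY: "(X, Y) \<noteq> (0, 0)"
  shows "\<exists>c\<in>F - {0}. line_form F a b (pt (X, Y, Z)) huff_O = scale c (Y, - X, 0)"
proof -
  note closed = subfield_closed[OF F]
  have gF: "(Y, - X, 0) \<in> F \<times> F \<times> F" using S by (auto intro!: closed)
  have "pt (X, Y, Z) \<noteq> pt (0, 0, 1)" using XY by (auto simp: pt_eq_iff)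
  then have l: "line_through a b (pt (X, Y, Z)) huff_O (Y, - X, 0)"
    using XY by (auto simp: line_through_def pt_def huff_O_def)
  define m where "m = line_form F a b (pt (X, Y, Z)) huff_O"
  have m: "m \<in> F \<times> F \<times> F" "line_through a b (pt (X, Y, Z)) huff_O m"
    using someI[of "\<lambda>l. l \<in> F \<times> F \<times> F \<and> line_through a b (pt (X, Y, Z)) huff_O l" "(Y, - X, 0)"] gF l
    unfolding m_def line_form_def by blast+
  obtain c where c: "c \<noteq> 0" "m = scale c (Y, - X, 0)"
    using line_through_unique[OF refl _ _ _ l m(2), of "(0, 0, 1)"] XY
    by (auto simp: huff_O_def)
  then have cF: "c * Y \<in> F" "c * - X \<in> F" using m(1) by auto
  have "c \<in> F"
  proof (cases "Y = 0")
    case True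
    then show ?thesis using closed(7)[OF cF(2) closed(5)[OF S(1)]] XY by simp
  next
    case False
    then show ?thesis using closed(7)[OF cF(1) S(2)] by simp
  qed
  with c show ?thesis by (auto simp: m_def)
qed

text \<open>On that line, \<open>y\<close> would lie in \<open>F\<close>. For \<open>y\<close> other
  than 1 the curve equation determines the square of the third coordinate, so \<open>w\<close> would
  be Z / X up to sign and the point would be defined over \<open>F\<close>.\<close>

lemma not_on_vertical_line:
  fixes a b X Y Z y w :: "'a::field"
  assumes F: "subfield_of F" and ab: "a \<noteq> b"
    and S: "X \<in> F" "Y \<in> F" "Z \<in> F" "(X, Y) \<noteq> (0, 0)" "huff a b (X, Y, Z) = 0"
    and Q: "huff a b (1, y, w) = 0" "pt (1, y, w) \<notin> huff_points F a b"
  shows "Y - X * y \<noteq> 0"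
proof
  note closed = subfield_closed[OF F]
  assume "Y - X * y = 0"
  then have Y: "Y = X * y" by simp
  with S(4) have X: "X \<noteq> 0" by auto
  define \<xi> where "\<xi> = Z / X"
  have \<xi>: "\<xi> \<in> F" using closed S by (simp add: \<xi>_def)
  have y: "y \<in> F" using closed(7)[OF S(2,1)] X Y by simp
  have "(X, Y, Z) = scale X (1, y, \<xi>)" using X Y by (simp add: \<xi>_def)
  then have "huff a b (1, y, \<xi>) = 0"
    using S(5) X by (simp only: huff_scale) simp
  then have "a * y\<^sup>2 - \<xi>\<^sup>2 = y * (b - \<xi>\<^sup>2)" "a * y\<^sup>2 - w\<^sup>2 = y * (b - w\<^sup>2)" using Q(1) by simp_all
  then have "(y - 1) * ((w - \<xi>) * (w + \<xi>)) = 0" by algebra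
  moreover have "y \<noteq> 1"
    using Q(1) huff_diagonal[of a b 1 w] ab by auto
  ultimately have "w = \<xi> \<or> w = - \<xi>" by (auto simp: eq_neg_iff_add_eq_0)
  then have "w \<in> F" using \<xi> closed by auto
  then have "pt (1, y, w) \<in> huff_points F a b"
    using Q(1) y closed(2) unfolding huff_points_def
    by (intro CollectI exI[of _ "(1, y, w)"]) (auto simp del: huff.simps)
  with Q(2) show False ..
qed

section \<open>The straight-line program\<close>

text \<open>Positions 0 to 3 hold X, Y, Z, f, and 4 and 5 the precomputed coordinates of Q.
  Positions 11 and 12 receive A and B; 14 and 15 receive Y^2 B and X^2 A, used for both the double
  and the tangent. The double appears at 24, 25, 28, the tangent value at 32 and the new Miller
  value at 34.\<close>

definition doubling_program :: "operation list" where
  "doubling_program =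
    [Sq_Base 0, Sq_Base 1, Sq_Base 2, Mul_Const_a 7, Mul_Const_b 6,
     Add 9 8, Add 10 8, Sub 8 9, Mul_Base 7 12, Mul_Base 6 11,
     Mul_Base 0 1, Add 16 16, Sub 1 0, Mul_Base 2 18, Mul_Base 17 19,
     Mul_Base 15 11, Mul_Base 14 12, Add 2 2, Mul_Base 23 21, Mul_Base 23 22,
     Mul_Base 11 12, Mul_Base 0 13, Mul_Base 26 27,
     Mul_Base_Half 15 4, Mul_Base_Half 20 5, Sub 29 14, Add 31 30, Sq_Full 3, Mul_Full 33 32]"

text \<open>The products with the two coordinates of Q contribute 2 * (k div 2), which is k for even
  k. Three base field squarings suffice, two fewer than allowed.\<close>

lemma doubling_program_cost:
  "cost k doubling_program Cost_M = 1" "cost k doubling_program Cost_S = 1"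
  "cost k doubling_program Cost_m = 2 * (k div 2) + 12" "cost k doubling_program Cost_s = 3"
  "cost k doubling_program Cost_c = 2"
  by (simp_all add: cost_def doubling_program_def)

lemma run_doubling_program:
  fixes a b X Y Z :: "'a::field"
  assumes F: "subfield_of Fq" and base: "a \<in> Fq" "b \<in> Fq" "X \<in> Fq" "Y \<in> Fq" "Z \<in> Fq"
    and Q: "y \<in> Fh" "z \<in> Fh"
  shows "\<exists>vs. run Fq Fh \<alpha> a b doubling_program ([X, Y, Z, f] @ [y, z * \<alpha>]) = Some vs \<and>
    length vs = 35 \<and> (vs ! 24, vs ! 25, vs ! 28) = double_coords a b (X, Y, Z) \<and>
    vs ! 34 = f\<^sup>2 * (X\<^sup>2 * (a * Y\<^sup>2 + Z\<^sup>2) * y - Y\<^sup>2 * (b * X\<^sup>2 + Z\<^sup>2)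
      + 2 * (X * Y) * (Z * (Y - X)) * (z * \<alpha>)) \<and> vs ! 24 \<in> Fq \<and> vs ! 25 \<in> Fq \<and> vs ! 28 \<in> Fq"
proof -
  note closed = subfield_closed[OF F]
  \<comment> \<open>One name per list position keeps the terms small during the symbolic
    run.\<close>
  obtain v6 v7 v8 v9 v10 v11 v12 v13 v14 v15 v16 v17 v18 v19 v20 v21 v22 v23 v24 v25 v26 v27 v28
    v29 v30 v31 v32 v33 v34
    where eqs: "X\<^sup>2 = v6" "Y\<^sup>2 = v7" "Z\<^sup>2 = v8" "a * v7 = v9" "b * v6 = v10"
      "v9 + v8 = v11" "v10 + v8 = v12" "v8 - v9 = v13" "v7 * v12 = v14" "v6 * v11 = v15"
      "X * Y = v16" "v16 + v16 = v17" "Y - X = v18" "Z * v18 = v19" "v17 * v19 = v20"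
      "v15 * v11 = v21" "v14 * v12 = v22" "Z + Z = v23" "v23 * v21 = v24" "v23 * v22 = v25"
      "v11 * v12 = v26" "X * v13 = v27" "v26 * v27 = v28"
      "v15 * y = v29" "v20 * (z * \<alpha>) = v30" "v29 - v14 = v31" "v31 + v30 = v32"
      "f\<^sup>2 = v33" "v33 * v32 = v34"
    by (rule that) (rule refl)+
  have mem: "v6 \<in> Fq" "v7 \<in> Fq" "v8 \<in> Fq" "v9 \<in> Fq" "v10 \<in> Fq" "v11 \<in> Fq" "v12 \<in> Fq" "v13 \<in> Fq"
    "v14 \<in> Fq" "v15 \<in> Fq" "v16 \<in> Fq" "v17 \<in> Fq" "v18 \<in> Fq" "v19 \<in> Fq" "v20 \<in> Fq" "v21 \<in> Fq"
    "v22 \<in> Fq" "v23 \<in> Fq" "v24 \<in> Fq" "v25 \<in> Fq" "v26 \<in> Fq" "v27 \<in> Fq" "v28 \<in> Fq"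
    unfolding eqs[symmetric] by (intro closed base)+
  define vs where "vs = [X, Y, Z, f, y, z * \<alpha>, v6, v7, v8, v9, v10, v11, v12, v13, v14, v15, v16, v17,
    v18, v19, v20, v21, v22, v23, v24, v25, v26, v27, v28, v29, v30, v31, v32, v33, v34]"
  have "run Fq Fh \<alpha> a b doubling_program ([X, Y, Z, f] @ [y, z * \<alpha>]) = Some vs"
    unfolding doubling_program_def vs_def using Q by (simp add: eqs mem base image_iff) blast
  moreover have "length vs = 35" "vs ! 24 = v24" "vs ! 25 = v25" "vs ! 28 = v28" "vs ! 34 = v34"
    by (simp_all add: vs_def)
  moreover have "(v24, v25, v28) = double_coords a b (X, Y, Z)"
    unfolding eqs[symmetric] by (simp add: power2_eq_square algebra_simps)
  moreover have "v34 = f\<^sup>2 * (X\<^sup>2 * (a * Y\<^sup>2 + Z\<^sup>2) * y - Y\<^sup>2 * (b * X\<^sup>2 + Z\<^sup>2)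
      + 2 * (X * Y) * (Z * (Y - X)) * (z * \<alpha>))"
    unfolding eqs[symmetric] by (simp add: power2_eq_square algebra_simps)
  ultimately show ?thesis using mem by auto
qed

section \<open>The Miller value and the conclusion\<close>

text \<open>The extra factor x y is what turns the tangent coefficients into quantities shared with
  the doubling formula; it lies in the base field and is harmless.\<close>

lemma tangent_value:
  fixes a b x y z :: "'a::idom"
  assumes "huff a b (x, y, z) = 0"
  shows "x * y * lin (huff_grad a b (x, y, z)) (1, v, w) =
    x\<^sup>2 * (a * y\<^sup>2 + z\<^sup>2) * v - y\<^sup>2 * (b * x\<^sup>2 + z\<^sup>2) + 2 * (x * y) * (z * (y - x)) * w"
proof -
  have "x * (a * y\<^sup>2 - z\<^sup>2) - y * (b * x\<^sup>2 - z\<^sup>2) = 0" using assms by simp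
  then have "x * y * ((a * y\<^sup>2 - z\<^sup>2 - 2 * b * x * y) + (2 * a * x * y - (b * x\<^sup>2 - z\<^sup>2)) * v
      + (2 * y * z - 2 * x * z) * w) =
    x\<^sup>2 * (a * y\<^sup>2 + z\<^sup>2) * v - y\<^sup>2 * (b * x\<^sup>2 + z\<^sup>2) + 2 * (x * y) * (z * (y - x)) * w"
    by algebra
  then show ?thesis by simp
qed

theorem mainTheorem2:
  fixes Fq Fh :: "'a::{field,finite} set"
    and a b \<alpha> y\<^sub>Q z\<^sub>Q :: 'a
    and P Q :: "'a triple set"
    and p q r k :: nat
  assumes "p = CHAR('a)" and "p \<noteq> 2"
    and "subfield_of Fq" and "card Fq = q"
    and "a \<in> Fq" and "b \<in> Fq" and "a * b * (a - b) \<noteq> 0"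
    and "prime r" and "r > 5" and "r \<noteq> p" and "r dvd card (huff_points Fq a b)"
    and "k = embedding_degree q r" and "even k"
    and "card (UNIV :: 'a set) = q ^ k"
    and "subfield_of Fh" and "Fq \<subseteq> Fh" and "card Fh = q ^ (k div 2)"
    and "adjoin Fh \<alpha> = UNIV" and "\<alpha>^2 \<in> Fh" and "\<not> (\<exists>\<beta>\<in>Fh. \<beta>^2 = \<alpha>^2)"
    and "P \<in> huff_points Fq a b" and "has_order a b P r"
    and "Q \<in> huff_points UNIV a b" and "huff_mult a b r Q = huff_O"
    and "Q \<notin> huff_points Fq a b"
    and "y\<^sub>Q \<in> Fh" and "z\<^sub>Q \<in> Fh" and "Q = pt (1, y\<^sub>Q, z\<^sub>Q * \<alpha>)"
  shows "\<exists>cs. performs_doubling_step Fq Fh \<alpha> a b r (1, y\<^sub>Q, z\<^sub>Q * \<alpha>) cs \<and>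
           cost k cs Cost_M \<le> 1 \<and> cost k cs Cost_S \<le> 1 \<and> cost k cs Cost_m \<le> k + 12 \<and>
           cost k cs Cost_s \<le> 5 \<and> cost k cs Cost_c \<le> 2"
proof (intro exI conjI)
  note Fq = \<open>subfield_of Fq\<close> and Fh = \<open>subfield_of Fh\<close> and ab = \<open>a * b * (a - b) \<noteq> 0\<close>
  note closed = subfield_closed[OF Fh]
  have two: "(2::'a) \<noteq> 0"
  proof
    assume "(2::'a) = 0"
    then have "CHAR('a) dvd 2" using of_nat_eq_0_iff_char_dvd[of 2, where 'a = 'a] by simp
    then have "CHAR('a) = 1 \<or> CHAR('a) = 2" using prime_nat_iff two_is_prime_nat by blast
    moreover have "CHAR('a) \<noteq> 1" using of_nat_CHAR[where 'a = 'a] by auto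
    ultimately show False using assms(1,2) by simp
  qed
  have ne: "a \<noteq> b" using ab by auto
  have Q: "huff a b (1, y\<^sub>Q, z\<^sub>Q * \<alpha>) = 0"
    using assms huff_points_coords by blast
  show "performs_doubling_step Fq Fh \<alpha> a b r (1, y\<^sub>Q, z\<^sub>Q * \<alpha>) doubling_program"
    unfolding performs_doubling_step_def
  \<comment> \<open>Only the coordinates of Q are precomputed; the numbers are the output positions
    of the program.\<close>
  proof (rule exI[of _ "[y\<^sub>Q, z\<^sub>Q * \<alpha>]"], rule exI[of _ 24], rule exI[of _ 25], rule exI[of _ 28],
      rule exI[of _ 34], intro allI impI, elim conjE)
    fix R and x y z f :: 'a
    assume RE: "R \<in> huff_points Fq a b" and ord: "has_order a b R r"
      and co: "is_coords Fq R (x, y, z)"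
    then have R: "R = pt (x, y, z)" "x \<in> Fq" "y \<in> Fq" "z \<in> Fq" "(x, y, z) \<noteq> (0, 0, 0)"
      by (auto simp: is_coords_def)
    have cv: "huff a b (x, y, z) = 0" using RE R huff_points_coords by blast
    have nz: "x \<noteq> 0" "y \<noteq> 0" "z \<noteq> 0" "x \<noteq> y"
      using odd_order_coords[OF ab cv R(5)] ord \<open>r > 5\<close> unfolding R(1) by simp_all
    obtain X Y Z where D: "double_coords a b (x, y, z) = (X, Y, Z)" by (metis prod_cases3)
    have XY: "(X, Y) \<noteq> (0, 0)" using double_coords_xy_nonzero[OF two ne cv nz(1-3) D] .
    have cD: "huff a b (X, Y, Z) = 0" and dbl: "huff_add a b R R = pt (X, Y, Z)"
      using huff_double[OF two ne cv nz] by (simp_all only: D R(1))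
    obtain vs where vs: "run Fq Fh \<alpha> a b doubling_program ([x, y, z, f] @ [y\<^sub>Q, z\<^sub>Q * \<alpha>]) = Some vs"
      "length vs = 35" "(vs ! 24, vs ! 25, vs ! 28) = (X, Y, Z)"
      "vs ! 34 = f\<^sup>2 * (x * y * lin (huff_grad a b (x, y, z)) (1, y\<^sub>Q, z\<^sub>Q * \<alpha>))"
      and F: "X \<in> Fq" "Y \<in> Fq" "Z \<in> Fq"
      using run_doubling_program[OF Fq \<open>a \<in> Fq\<close> \<open>b \<in> Fq\<close> R(2-4) \<open>y\<^sub>Q \<in> Fh\<close> \<open>z\<^sub>Q \<in> Fh\<close>, of \<alpha> f]
      unfolding D tangent_value[OF cv] by auto
    obtain e where e: "e \<in> Fq - {0}" "line_form Fq a b R R = scale e (huff_grad a b (x, y, z))"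
      using line_form_tangent[OF Fq \<open>a \<in> Fq\<close> \<open>b \<in> Fq\<close> R(2-4)] two nz R(1) by auto
    obtain c where c: "c \<in> Fq - {0}" "line_form Fq a b (pt (X, Y, Z)) huff_O = scale c (Y, - X, 0)"
      using line_form_vertical[OF Fq F(1,2) XY] by blast
    \<comment> \<open>With a zero denominator \<open>miller_g\<close> would be 0 by the convention
      on division, and the comparison of values would fail.\<close>
    have vert: "Y - X * y\<^sub>Q \<noteq> 0"
      using not_on_vertical_line[OF Fq ne F XY cD Q] assms by blast
    \<comment> \<open>This collects the factor x y, the vertical line's value and the constants of
      the chosen forms. The vertical form has no Z term, so \<alpha> does not enter and
      \<open>w\<close> stays in \<open>Fh\<close>.\<close>
    define w where "w = x * y * (c * (Y - X * y\<^sub>Q)) / e"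
    have "x \<in> Fh" "y \<in> Fh" "c \<in> Fh" "X \<in> Fh" "Y \<in> Fh" "e \<in> Fh"
      using R F c e \<open>Fq \<subseteq> Fh\<close> by auto
    then have "w \<in> Fh" unfolding w_def using \<open>y\<^sub>Q \<in> Fh\<close> by (intro closed)
    moreover have "w \<noteq> 0" using nz c e vert by (simp add: w_def)
    moreover have "vs ! 34 = w * (f\<^sup>2 * miller_g Fq a b R R (1, y\<^sub>Q, z\<^sub>Q * \<alpha>))"
    proof -
      have g: "miller_g Fq a b R R (1, y\<^sub>Q, z\<^sub>Q * \<alpha>) =
          e * lin (huff_grad a b (x, y, z)) (1, y\<^sub>Q, z\<^sub>Q * \<alpha>) / (c * (Y - X * y\<^sub>Q))"
        unfolding miller_g_def miller_l_def dbl e(2) c(2) lin_scale_left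
        by (simp add: mult.commute del: huff_grad.simps)
      show ?thesis
        unfolding vs(4) g w_def using c(1) e(1) vert by (simp add: field_simps del: huff_grad.simps)
    qed
    moreover have "is_coords Fq (huff_add a b R R) (vs ! 24, vs ! 25, vs ! 28)"
      unfolding vs(3) dbl is_coords_def using F XY by auto
    ultimately show "\<exists>vs. run Fq Fh \<alpha> a b doubling_program ([x, y, z, f] @ [y\<^sub>Q, z\<^sub>Q * \<alpha>]) = Some vs \<and>
        {24, 25, 28, 34} \<subseteq> {..<length vs} \<and>
        is_coords Fq (huff_add a b R R) (vs ! 24, vs ! 25, vs ! 28) \<and>
        (\<exists>w\<in>Fh - {0}. vs ! 34 = w * (f\<^sup>2 * miller_g Fq a b R R (1, y\<^sub>Q, z\<^sub>Q * \<alpha>)))"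
      using vs(1,2) by (intro exI[of _ vs]) auto
  qed
qed (use \<open>even k\<close> in \<open>simp_all add: doubling_program_cost\<close>)

end
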